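(* Let $n\geq 1$. The monoid $\mathrm{K}_n$ has a faithful representation by $n\times n$ matrices with non-negative integer coefficients, that is, there exists an injective monoid homomorphism from $\mathrm{K}_n$ to the multiplicative monoid of $n\times n$ matrices with non-negative integer entries.
   Context: For a positive integer $n$, Kiselman's semigroup $\mathrm{K}_n$ is the monoid (with unit element $e$) given by the monoid presentation with generators $a_1,\dots,a_n$ and relations $a_i^2=a_i$ for $i=1,\dots,n$, and $a_ia_ja_i=a_ja_ia_j=a_ja_i$ for all $1\leq i<j\leq n$. *)

theory Defs
  imports "HOL-Algebra.Group" "Jordan_Normal_Form.Matrix"
begin

text \<open>
  Elements of the free monoid on \<open>X\<close> are the words \<open>lists X\<close> under concatenation.
  The relation \<open>pres_cong X R\<close> is the smallest monoid congruence on it that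
  identifies the two sides of every defining relation in \<open>R\<close>.
\<close>

inductive_set pres_cong :: "'a set \<Rightarrow> ('a list \<times> 'a list) set \<Rightarrow> ('a list \<times> 'a list) set"
  for X :: "'a set" and R :: "('a list \<times> 'a list) set"
where
  base: "(u, v) \<in> R \<Longrightarrow> u \<in> lists X \<Longrightarrow> v \<in> lists X \<Longrightarrow> (u, v) \<in> pres_cong X R"
| refl: "u \<in> lists X \<Longrightarrow> (u, u) \<in> pres_cong X R"
| sym: "(u, v) \<in> pres_cong X R \<Longrightarrow> (v, u) \<in> pres_cong X R"
| trans: "(u, v) \<in> pres_cong X R \<Longrightarrow> (v, w) \<in> pres_cong X R \<Longrightarrow> (u, w) \<in> pres_cong X R"
| append: "(u, v) \<in> pres_cong X R \<Longrightarrow> (u', v') \<in> pres_cong X R \<Longrightarrow>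
    (u @ u', v @ v') \<in> pres_cong X R"

definition presented_monoid :: "'a set \<Rightarrow> ('a list \<times> 'a list) set \<Rightarrow> 'a list set monoid" where
  "presented_monoid X R = \<lparr>
     carrier = lists X // pres_cong X R,
     mult = (\<lambda>A B. \<Union>u\<in>A. \<Union>v\<in>B. pres_cong X R `` {u @ v}),
     one = pres_cong X R `` {[]}\<rparr>"

text \<open>The generator \<open>a\<^sub>i\<close> is represented by its index \<open>i\<close>.\<close>

definition kiselman_rels :: "nat \<Rightarrow> (nat list \<times> nat list) set" where
  "kiselman_rels n =
     {([i, i], [i]) | i. 1 \<le> i \<and> i \<le> n} \<union>
     {([i, j, i], [j, i]) | i j. 1 \<le> i \<and> i < j \<and> j \<le> n} \<union>
     {([j, i, j], [j, i]) | i j. 1 \<le> i \<and> i < j \<and> j \<le> n}"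

definition kiselman :: "nat \<Rightarrow> nat list set monoid" where
  "kiselman n = presented_monoid {1..n} (kiselman_rels n)"

lemma pres_cong_words:
  "(u, v) \<in> pres_cong X R \<Longrightarrow> u \<in> lists X \<and> v \<in> lists X"
  by (induction rule: pres_cong.induct) auto

lemma equiv_pres_cong: "equiv (lists X) (pres_cong X R)"
proof (rule equivI)
  show "pres_cong X R \<subseteq> lists X \<times> lists X"
    using pres_cong_words by (metis mem_Sigma_iff subrelI)
  show "refl_on (lists X) (pres_cong X R)"
    by (intro refl_onI pres_cong.refl)
  show "sym (pres_cong X R)"
    by (intro symI) (rule pres_cong.sym)
  show "trans (pres_cong X R)"
    by (intro transI) (rule pres_cong.trans)
qed

lemma carrier_presented_monoid:
  "carrier (presented_monoid X R) = lists X // pres_cong X R"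
  by (simp add: presented_monoid_def)

lemma one_presented_monoid:
  "\<one>\<^bsub>presented_monoid X R\<^esub> = pres_cong X R `` {[]}"
  by (simp add: presented_monoid_def)

lemma mult_presented_monoid:
  assumes "u \<in> lists X" "v \<in> lists X"
  shows "(pres_cong X R `` {u}) \<otimes>\<^bsub>presented_monoid X R\<^esub> (pres_cong X R `` {v}) =
    pres_cong X R `` {u @ v}"
proof -
  have eq: "pres_cong X R `` {u' @ v'} = pres_cong X R `` {u @ v}"
    if "u' \<in> pres_cong X R `` {u}" "v' \<in> pres_cong X R `` {v}" for u' v'
  proof -
    have "(u @ v, u' @ v') \<in> pres_cong X R"
      using that by (intro pres_cong.append) simp_all
    from equiv_class_eq[OF equiv_pres_cong this] show ?thesis by simp
  qed
  have "u \<in> pres_cong X R `` {u}" "v \<in> pres_cong X R `` {v}"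
    using assms by (simp_all add: pres_cong.refl)
  then have "(\<Union>u'\<in>pres_cong X R `` {u}. \<Union>v'\<in>pres_cong X R `` {v}.
      pres_cong X R `` {u' @ v'}) = pres_cong X R `` {u @ v}"
    using eq by blast
  then show ?thesis
    by (simp add: presented_monoid_def)
qed

lemma monoid_presented_monoid: "monoid (presented_monoid X R)"
proof -
  let ?M = "presented_monoid X R" and ?c = "\<lambda>u. pres_cong X R `` {u}"
  have closed: "?c u \<in> carrier ?M" if "u \<in> lists X" for u
    unfolding carrier_presented_monoid using that by (rule quotientI)
  have rep: "\<exists>u \<in> lists X. A = ?c u" if "A \<in> carrier ?M" for A
    using that by (auto simp: carrier_presented_monoid quotient_def)
  have nil: "[] \<in> lists X" by simp
  have app: "u @ v \<in> lists X" if "u \<in> lists X" "v \<in> lists X" for u v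
    using that by simp
  note mult = mult_presented_monoid[where X = X and R = R]
  show ?thesis
  proof (rule monoidI)
    show "\<one>\<^bsub>?M\<^esub> \<in> carrier ?M"
      unfolding one_presented_monoid by (rule closed[OF nil])
  next
    fix A B assume "A \<in> carrier ?M" "B \<in> carrier ?M"
    then obtain u v where "u \<in> lists X" "v \<in> lists X" "A = ?c u" "B = ?c v"
      using rep by meson
    then show "A \<otimes>\<^bsub>?M\<^esub> B \<in> carrier ?M"
      by (simp only: mult closed app)
  next
    fix A B C assume "A \<in> carrier ?M" "B \<in> carrier ?M" "C \<in> carrier ?M"
    then obtain u v w where "u \<in> lists X" "v \<in> lists X" "w \<in> lists X"
      "A = ?c u" "B = ?c v" "C = ?c w"
      using rep by meson
    then show "A \<otimes>\<^bsub>?M\<^esub> B \<otimes>\<^bsub>?M\<^esub> C = A \<otimes>\<^bsub>?M\<^esub> (B \<otimes>\<^bsub>?M\<^esub> C)"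
      by (simp only: mult app append_assoc)
  next
    fix A assume "A \<in> carrier ?M"
    then obtain u where "u \<in> lists X" "A = ?c u"
      using rep by meson
    then show "\<one>\<^bsub>?M\<^esub> \<otimes>\<^bsub>?M\<^esub> A = A" "A \<otimes>\<^bsub>?M\<^esub> \<one>\<^bsub>?M\<^esub> = A"
      by (simp_all only: one_presented_monoid mult nil append_Nil append_Nil2)
  qed
qed

lemma monoid_kiselman: "monoid (kiselman n)"
  by (simp add: kiselman_def monoid_presented_monoid)

lemma monoid_ring_mat: "monoid (ring_mat TYPE('a :: semiring_1) n b)"
  by (rule monoidI) (auto simp: ring_mat_def)

end

theory Submission
  imports Defs "HOL-Library.Sublist" "HOL-Library.Nat_Bijection"
begin

text \<open>
  Two words represent the same element of Kiselman's semigroup iff they have the same strictly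
  decreasing subwords: a word of minimal length in its class can be read off, letter by letter
  from the left, from its set of strictly decreasing subwords.

  Let \<open>a\<^sub>i\<close> act on row vectors by replacing the entry \<open>x\<^sub>i\<close> with \<open>b\<^sub>i (x\<^bsub>i+1\<^esub> + \<dots> + x\<^sub>n)\<close>.
  The \<open>(r, l)\<close> entry of the matrix of a word is then the sum, over the decreasing subwords \<open>x\<close> for
  which \<open>r # x\<close> is decreasing, ends in \<open>l\<close> and is no longer a subword, of the product of the \<open>b\<^sub>i\<close>
  over the letters of \<open>x\<close>. With \<open>b\<^sub>i = 2^(2^i)\<close> these products are distinct powers of 2, so that the
  binary digits of the entries determine all decreasing subwords.
\<close>

section \<open>Decreasing subwords\<close>

definition desc_subwords :: "'a::linorder list \<Rightarrow> 'a list set" where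
  "desc_subwords w = {x. sorted_wrt (>) x \<and> subseq x w}"

lemma desc_subwords_set: "x \<in> desc_subwords w \<Longrightarrow> set x \<subseteq> set w"
  by (auto simp: desc_subwords_def elim: list_emb_set)

text \<open>Since factors of a decreasing word are decreasing, the sets for \<open>u\<close> and
  \<open>v\<close> determine the set for \<open>u @ v\<close>; equality of
  \<open>desc_subwords\<close> is therefore a congruence.\<close>

lemma desc_subwords_append:
  "desc_subwords (u @ v) =
    {x. sorted_wrt (>) x \<and>
      (\<exists>y z. x = y @ z \<and> y \<in> desc_subwords u \<and> z \<in> desc_subwords v)}"
  unfolding desc_subwords_def subseq_append_iff mem_Collect_eq
  by (rule Collect_cong) (metis sorted_wrt_append)

lemma desc_subwords_subseqs: "desc_subwords w = {x \<in> set (subseqs w). sorted_wrt (>) x}"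
  by (auto simp: desc_subwords_def)

lemma desc_subwords_idem: "desc_subwords [i, i] = desc_subwords [i]"
  by (auto simp: desc_subwords_subseqs Let_def simp del: in_set_subseqs)

lemma desc_subwords_braid:
  assumes "i < j"
  shows "desc_subwords [i, j, i] = desc_subwords [j, i]"
    and "desc_subwords [j, i, j] = desc_subwords [j, i]"
  using assms by (auto simp: desc_subwords_subseqs Let_def simp del: in_set_subseqs)

abbreviation kis_cong :: "nat \<Rightarrow> (nat list \<times> nat list) set" where
  "kis_cong n \<equiv> pres_cong {1..n} (kiselman_rels n)"

lemma desc_subwords_cong:
  "(u, v) \<in> kis_cong n \<Longrightarrow> desc_subwords u = desc_subwords v"
proof (induction rule: pres_cong.induct)
  case (base u v)
  then show ?case
    by (auto simp: kiselman_rels_def desc_subwords_idem desc_subwords_braid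
        simp del: One_nat_def)
qed (simp_all add: desc_subwords_append)

section \<open>Words of minimal length\<close>

lemma kis_cong_context:
  assumes "(u, v) \<in> kis_cong n" "p \<in> lists {1..n}" "q \<in> lists {1..n}"
  shows "(p @ u @ q, p @ v @ q) \<in> kis_cong n"
  using assms by (intro pres_cong.append pres_cong.refl)

text \<open>The relation \<open>i c i = c i\<close> for \<open>i < c\<close>, extended from one
  letter \<open>c\<close> to a word \<open>t\<close> of letters above \<open>i\<close>.\<close>

lemma kis_cong_drop_left:
  assumes "i \<in> {1..n}" "t \<in> lists {i<..n}"
  shows "(i # t @ [i], t @ [i]) \<in> kis_cong n"
  using assms(2)
proof (induction t)
  case Nil
  show ?case
    using assms(1) by (auto intro!: pres_cong.base simp: kiselman_rels_def)
next
  case (Cons c t)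
  have c: "i < c" "c \<le> n" and t: "t \<in> lists {1..n}"
    using Cons assms by (auto simp: in_lists_conv_set)
  have IH: "(i # t @ [i], t @ [i]) \<in> kis_cong n"
    using Cons by simp
  have "([i, c, i], [c, i]) \<in> kis_cong n"
    using c assms(1) by (intro pres_cong.base) (auto simp: kiselman_rels_def)
  \<comment> \<open>The induction hypothesis, read backwards, inserts a helper \<open>i\<close>
    after \<open>c\<close>; the relation then deletes the leading \<open>i\<close>, and the
    induction hypothesis removes the helper.\<close>
  from kis_cong_context[OF this, of "[]" "t @ [i]"]
  have 1: "(i # c # i # t @ [i], c # i # t @ [i]) \<in> kis_cong n"
    using t assms(1) by simp
  have 2: "(i # c # t @ [i], i # c # i # t @ [i]) \<in> kis_cong n"
    using kis_cong_context[OF pres_cong.sym[OF IH], of "[i, c]" "[]"] c assms(1) by simp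
  have 3: "(c # i # t @ [i], c # t @ [i]) \<in> kis_cong n"
    using kis_cong_context[OF IH, of "[c]" "[]"] c assms(1) by simp
  show ?case
    using pres_cong.trans[OF 2 pres_cong.trans[OF 1 3]] by simp
qed

text \<open>The mirror image: for \<open>c < i\<close> the relation is \<open>i c i = i c\<close>,
  so the right occurrence of \<open>i\<close> is the redundant one.\<close>

lemma kis_cong_drop_right:
  assumes "i \<in> {1..n}" "t \<in> lists {1..<i}"
  shows "(i # t @ [i], i # t) \<in> kis_cong n"
  using assms(2)
proof (induction t rule: rev_induct)
  case Nil
  show ?case
    using assms(1) by (auto intro!: pres_cong.base simp: kiselman_rels_def)
next
  case (snoc c t)
  have c: "c < i" "1 \<le> c" "c \<le> n" and t: "t \<in> lists {1..n}"
    using snoc assms by (auto simp: in_lists_conv_set)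
  have IH: "(i # t @ [i], i # t) \<in> kis_cong n"
    using snoc by simp
  have "([i, c, i], [i, c]) \<in> kis_cong n"
    using c assms(1) by (intro pres_cong.base) (auto simp: kiselman_rels_def)
  from kis_cong_context[OF this, of "i # t" "[]"]
  have 1: "(i # t @ [i, c, i], i # t @ [i, c]) \<in> kis_cong n"
    using t assms(1) by simp
  have 2: "(i # t @ [c, i], i # t @ [i, c, i]) \<in> kis_cong n"
    using kis_cong_context[OF pres_cong.sym[OF IH], of "[]" "[c, i]"] c assms(1) by simp
  have 3: "(i # t @ [i, c], i # t @ [c]) \<in> kis_cong n"
    using kis_cong_context[OF IH, of "[]" "[c]"] c assms(1) by simp
  show ?case
    using pres_cong.trans[OF 2 pres_cong.trans[OF 1 3]] by simp
qed

section \<open>Shortest representatives and absorption of a letter\<close>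

definition minimal_word :: "nat \<Rightarrow> nat list \<Rightarrow> bool" where
  "minimal_word n w \<longleftrightarrow>
    w \<in> lists {1..n} \<and> (\<forall>v. (w, v) \<in> kis_cong n \<longrightarrow> length w \<le> length v)"

lemma minimal_word_suffix:
  assumes "minimal_word n (u @ v)"
  shows "minimal_word n v"
  unfolding minimal_word_def
proof (intro conjI allI impI)
  show "v \<in> lists {1..n}"
    using assms by (auto simp: minimal_word_def)
  fix v' assume "(v, v') \<in> kis_cong n"
  then have "(u @ v, u @ v') \<in> kis_cong n"
    using kis_cong_context[of v v' n u "[]"] assms by (auto simp: minimal_word_def)
  then have "length (u @ v) \<le> length (u @ v')"
    using assms unfolding minimal_word_def by blast
  then show "length v \<le> length v'" by simp
qed

lemma ex_minimal_word:
  assumes "w \<in> lists {1..n}"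
  shows "\<exists>v. (w, v) \<in> kis_cong n \<and> minimal_word n v"
proof -
  define v where "v = arg_min length (\<lambda>v. (w, v) \<in> kis_cong n)"
  have v: "(w, v) \<in> kis_cong n"
    unfolding v_def using assms by (intro arg_min_natI) (rule pres_cong.refl)
  moreover have "length v \<le> length v'" if "(v, v') \<in> kis_cong n" for v'
    unfolding v_def using pres_cong.trans[OF v that] by (rule arg_min_nat_le)
  ultimately show ?thesis
    unfolding minimal_word_def using pres_cong_words by blast
qed

text \<open>
  The idea is to write \<open>s = t @ i # s'\<close> with \<open>i\<close> not in \<open>t\<close>. If \<open>t\<close> has only letters above \<open>i\<close>, the
  relations apply directly. Otherwise the last letter \<open>k < i\<close> of \<open>t\<close> is absorbed by \<open>s'\<close> by induction;
  inserting it there makes its occurrence in \<open>t\<close> redundant, contradicting minimality.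
\<close>

lemma minimal_word_absorb:
  assumes "minimal_word n s" "i \<in> {1..n}"
    and "\<And>x. x \<in> desc_subwords s \<Longrightarrow> \<forall>y\<in>set x. y < i \<Longrightarrow> i # x \<in> desc_subwords s"
  shows "(i # s, s) \<in> kis_cong n"
  using assms
proof (induction "length s" arbitrary: s i rule: less_induct)
  case less
  note min = less.prems(1) and absorb = less.prems(3)
  have s: "s \<in> lists {1..n}"
    using min by (simp add: minimal_word_def)
  have "subseq [i] s"
    using absorb[of "[]"] by (simp add: desc_subwords_def)
  then have "i \<in> set s"
    by (simp only: subseq_singleton_left)
  then obtain t s' where s_eq: "s = t @ i # s'" and "i \<notin> set t"
    by (meson split_list_first)
  have tl: "t \<in> lists {1..n}" and sl': "s' \<in> lists {1..n}"
    using s by (auto simp: s_eq)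
  \<comment> \<open>The \<open>i\<close> displayed in \<open>s_eq\<close> is the first one in
    \<open>s\<close>, so whatever follows an \<open>i\<close> in a subword of \<open>s\<close> must
    fit into \<open>s'\<close>.\<close>
  have sub: "subseq x s'" if "sorted_wrt (>) x" "subseq x s" "\<forall>y\<in>set x. y < i" for x
  proof -
    have "subseq (i # x) s"
      using absorb[of x] that by (simp add: desc_subwords_def)
    then show ?thesis
      using \<open>i \<notin> set t\<close> unfolding s_eq by (induction t) auto
  qed
  have "\<forall>y\<in>set t. i < y"
  proof (rule ccontr)
    assume "\<not> (\<forall>y\<in>set t. i < y)"
    then have "\<exists>y\<in>set t. y < i"
      using \<open>i \<notin> set t\<close> by (metis linorder_neqE_nat)
    then obtain t' k t'' where t: "t = t' @ k # t''" and k: "k < i" and "\<forall>y\<in>set t''. \<not> y < i"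
      using split_list_last_prop[of t "\<lambda>y. y < i"] by blast
    then have t'': "t'' @ [i] \<in> lists {k<..n}"
      using tl less.prems(2) by (auto simp: in_lists_conv_set)
    have kn: "k \<in> {1..n}"
      using tl t by simp
    have ks': "(k # s', s') \<in> kis_cong n"
    proof (rule less.hyps)
      show "length s' < length s"
        by (simp add: s_eq)
      show "minimal_word n s'"
        using min minimal_word_suffix[of n "t @ [i]" s'] by (simp add: s_eq)
      show "k \<in> {1..n}" by (fact kn)
      fix x assume x: "x \<in> desc_subwords s'" "\<forall>y\<in>set x. y < k"
      then have "sorted_wrt (>) (k # x)" "\<forall>y\<in>set (k # x). y < i"
        using k by (auto simp: desc_subwords_def)
      moreover have "subseq (k # x) (k # t'' @ i # s')"
        using x by (auto simp: desc_subwords_def intro: list_emb_append2)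
      then have "subseq (k # x) s"
        by (simp add: s_eq t list_emb_append2)
      ultimately show "k # x \<in> desc_subwords s'"
        using sub by (auto simp: desc_subwords_def)
    qed
    have 1: "(s, t' @ k # (t'' @ [i]) @ k # s') \<in> kis_cong n"
      using kis_cong_context[OF pres_cong.sym[OF ks'], of "t @ [i]" "[]"] tl less.prems(2)
      by (simp add: s_eq t)
    have 2: "(t' @ k # (t'' @ [i]) @ k # s', t' @ (t'' @ [i]) @ k # s') \<in> kis_cong n"
      using kis_cong_context[OF kis_cong_drop_left[OF kn t''], of t' s'] tl sl' t by simp
    have 3: "(t' @ (t'' @ [i]) @ k # s', t' @ (t'' @ [i]) @ s') \<in> kis_cong n"
      using kis_cong_context[OF ks', of "t' @ t'' @ [i]" "[]"] tl t less.prems(2) by simp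
    have "length s \<le> length (t' @ (t'' @ [i]) @ s')"
      using min pres_cong.trans[OF 1 pres_cong.trans[OF 2 3]]
      unfolding minimal_word_def by blast
    then show False
      by (simp add: s_eq t)
  qed
  then have "(i # t @ [i], t @ [i]) \<in> kis_cong n"
    using tl less.prems(2) by (intro kis_cong_drop_left) (auto simp: in_lists_conv_set)
  from kis_cong_context[OF this, of "[]" s'] show ?case
    using sl' by (simp add: s_eq)
qed

section \<open>Reading a minimal word off its decreasing subwords\<close>

lemma minimal_word_not_absorb:
  assumes "minimal_word n (j # w)"
  shows "\<exists>x \<in> desc_subwords w. (\<forall>y\<in>set x. y < j) \<and> j # x \<notin> desc_subwords w"
proof (rule ccontr)
  assume "\<not> ?thesis"
  then have "(j # w, w) \<in> kis_cong n"
    using assms minimal_word_suffix[of n "[j]" w]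
    by (intro minimal_word_absorb) (auto simp: minimal_word_def)
  then have "length (j # w) \<le> length w"
    using assms unfolding minimal_word_def by blast
  then show False by simp
qed

text \<open>By minimality some decreasing \<open>j # x\<close> embeds into \<open>j # w\<close> only
  by using the first letter. If \<open>j < j'\<close>, then \<open>j' # j # x\<close> would also be
  a decreasing subword, and as it cannot use that first letter, it would put \<open>j # x\<close>
  inside \<open>w\<close>.\<close>

lemma minimal_word_first_letter_ge:
  assumes "minimal_word n (j # w)" and "desc_subwords (j # w) = desc_subwords (j' # w')"
  shows "j' \<le> j"
proof (rule ccontr)
  assume less: "\<not> j' \<le> j"
  obtain x where x: "x \<in> desc_subwords w" "\<forall>y\<in>set x. y < j" "j # x \<notin> desc_subwords w"
    using minimal_word_not_absorb[OF assms(1)] by blast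
  have "j # x \<in> desc_subwords (j' # w')"
    unfolding assms(2)[symmetric] using x by (auto simp: desc_subwords_def)
  then have "j' # j # x \<in> desc_subwords (j' # w')"
    using less by (auto simp: desc_subwords_def)
  then have "j' # j # x \<in> desc_subwords (j # w)"
    by (simp add: assms(2))
  then have "subseq (j # x) w"
    using less by (auto simp: desc_subwords_def dest: subseq_Cons')
  then show False
    using x by (auto simp: desc_subwords_def)
qed

text \<open>A subword not starting with \<open>j\<close> cannot use the leading \<open>j\<close>, so
  it passes from \<open>w\<close> to \<open>w'\<close> directly. One starting with \<open>j\<close>
  is first extended on the left by a larger letter, which minimality provides.\<close>

lemma desc_subwords_Cons_minimal_mono:
  assumes "minimal_word n (j # w)" and "desc_subwords (j # w) = desc_subwords (j # w')"
  shows "desc_subwords w \<subseteq> desc_subwords w'"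
proof
  fix x assume x: "x \<in> desc_subwords w"
  then have desc: "sorted_wrt (>) x"
    by (simp add: desc_subwords_def)
  have transfer: "z \<in> desc_subwords w'" if "z \<in> desc_subwords w" "z = [] \<or> hd z \<noteq> j" for z
  proof -
    have "z \<in> desc_subwords (j # w)"
      using that(1) by (auto simp: desc_subwords_def)
    then have "z \<in> desc_subwords (j # w')"
      by (simp add: assms(2))
    then show ?thesis
      using that(2) by (cases z) (auto simp: desc_subwords_def)
  qed
  show "x \<in> desc_subwords w'"
  proof (cases "x = [] \<or> hd x \<noteq> j")
    case True
    then show ?thesis using transfer x by blast
  next
    case False
    then obtain y where x_eq: "x = j # y"
      by (cases x) auto
    have "j \<in> set w"
      using desc_subwords_set[OF x] by (simp add: x_eq)
    then obtain t s where w: "w = t @ j # s" and "j \<notin> set t"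
      by (meson split_list_first)
    \<comment> \<open>If all letters of \<open>t\<close> were below \<open>j\<close>, the
      \<open>j\<close> after \<open>t\<close> would be redundant next to the leading one.\<close>
    have "\<exists>z\<in>set t. j < z"
    proof (rule ccontr)
      assume "\<not> (\<exists>z\<in>set t. j < z)"
      then have "t \<in> lists {1..<j}"
        using assms(1) \<open>j \<notin> set t\<close>
        by (auto simp: in_lists_conv_set minimal_word_def w) (metis linorder_neqE_nat)
      then have "(j # t @ [j], j # t) \<in> kis_cong n"
        using assms(1) by (intro kis_cong_drop_right) (auto simp: minimal_word_def)
      from kis_cong_context[OF this, of "[]" s]
      have "(j # w, j # t @ s) \<in> kis_cong n"
        using assms(1) by (auto simp: minimal_word_def w)
      then have "length (j # w) \<le> length (j # t @ s)"
        using assms(1) unfolding minimal_word_def by blast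
      then show False by (simp add: w)
    qed
    then obtain z where z: "z \<in> set t" "j < z" by blast
    have "subseq x (j # s)"
      using x \<open>j \<notin> set t\<close> unfolding w desc_subwords_def
      by (induction t) (auto simp: x_eq)
    moreover have "subseq [z] t"
      using z by (simp only: subseq_singleton_left)
    ultimately have "subseq ([z] @ x) w"
      unfolding w by (rule list_emb_append_mono[rotated])
    then have "z # x \<in> desc_subwords w"
      using desc z by (auto simp: desc_subwords_def x_eq)
    then have "z # x \<in> desc_subwords w'"
      using transfer z by simp
    then show ?thesis
      using desc by (auto simp: desc_subwords_def dest: subseq_Cons')
  qed
qed

lemma minimal_word_unique:
  assumes "minimal_word n w" "minimal_word n w'" "desc_subwords w = desc_subwords w'"
  shows "w = w'"
  using assms
proof (induction w arbitrary: w')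
  case Nil
  show ?case
  proof (cases w')
    case (Cons j v)
    then have "[j] \<in> desc_subwords w'"
      by (simp add: desc_subwords_def)
    then have "[j] \<in> desc_subwords []"
      by (simp add: Nil.prems(3))
    then show ?thesis
      by (simp add: desc_subwords_def)
  qed simp
next
  case (Cons j w)
  show ?case
  proof (cases w')
    case Nil
    have "[j] \<in> desc_subwords (j # w)"
      by (simp add: desc_subwords_def)
    then have "[j] \<in> desc_subwords []"
      using Cons.prems(3) Nil by simp
    then show ?thesis
      by (simp add: desc_subwords_def)
  next
    case w': (Cons j' v)
    have "j' = j"
      using Cons.prems minimal_word_first_letter_ge unfolding w' by (metis order.antisym)
    then have eq: "desc_subwords w = desc_subwords v"
      using Cons.prems desc_subwords_Cons_minimal_mono unfolding w' by (metis order.antisym)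
    have "minimal_word n w" "minimal_word n v"
      using Cons.prems(1,2) minimal_word_suffix[of n "[j]" w] minimal_word_suffix[of n "[j']" v]
      unfolding w' append_Cons append_Nil by blast+
    then have "w = v"
      using eq by (rule Cons.IH)
    then show ?thesis
      by (simp only: \<open>j' = j\<close> w')
  qed
qed

lemma kis_cong_iff_desc_subwords:
  assumes "u \<in> lists {1..n}" "v \<in> lists {1..n}"
  shows "(u, v) \<in> kis_cong n \<longleftrightarrow> desc_subwords u = desc_subwords v"
proof
  assume eq: "desc_subwords u = desc_subwords v"
  obtain u' v' where u': "(u, u') \<in> kis_cong n" "minimal_word n u'"
    and v': "(v, v') \<in> kis_cong n" "minimal_word n v'"
    using ex_minimal_word assms by meson
  then have "u' = v'"
    using eq desc_subwords_cong by (metis minimal_word_unique)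
  then show "(u, v) \<in> kis_cong n"
    using u'(1) v'(1) by (metis pres_cong.sym pres_cong.trans)
qed (rule desc_subwords_cong)

section \<open>The matrix of a word\<close>

text \<open>Using the last letter of \<open>r # x\<close> instead of \<open>x\<close> covers
  \<open>x = []\<close>, which contributes only when \<open>l = r\<close>.\<close>

definition paths :: "nat list \<Rightarrow> nat \<Rightarrow> nat \<Rightarrow> nat list set" where
  "paths w r l = {x \<in> desc_subwords w.
    (\<forall>y\<in>set x. y < r) \<and> r # x \<notin> desc_subwords w \<and> last (r # x) = l}"

text \<open>As \<open>set_encode\<close> sums \<open>2 ^ i\<close> over a finite set, each summand
  is the product of \<open>2 ^ 2 ^ i\<close> over the letters \<open>i\<close> of
  \<open>x\<close>.\<close>

definition path_weight :: "nat list \<Rightarrow> nat \<Rightarrow> nat \<Rightarrow> nat" where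
  "path_weight w r l = (\<Sum>x\<in>paths w r l. 2 ^ set_encode (set x))"

text \<open>Matrix indices start at 0, letters at 1.\<close>

definition word_mat :: "nat \<Rightarrow> nat list \<Rightarrow> nat mat" where
  "word_mat n w = mat n n (\<lambda>(r, l). path_weight w (Suc r) (Suc l))"

lemma word_mat_carrier [simp]: "word_mat n w \<in> carrier_mat n n"
  by (simp add: word_mat_def)

section \<open>Recovering the paths from the binary digits\<close>

lemma finite_paths: "finite (paths w r l)"
proof (rule finite_subset)
  show "paths w r l \<subseteq> set (subseqs w)"
    by (auto simp: paths_def desc_subwords_def)
qed simp

lemma inj_on_set_desc: "inj_on set {x :: nat list. sorted_wrt (>) x}"
proof (rule inj_onI)
  fix x y :: "nat list"
  assume "x \<in> {x. sorted_wrt (>) x}" "y \<in> {x. sorted_wrt (>) x}" "set x = set y"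
  then have "rev x = rev y"
    by (intro strict_sorted_equal) (auto simp: sorted_wrt_rev)
  then show "x = y" by simp
qed

lemma inj_on_encode_desc: "inj_on (set_encode \<circ> set) {x :: nat list. sorted_wrt (>) x}"
  by (rule comp_inj_on[OF inj_on_set_desc inj_on_subset[OF inj_on_set_encode]]) auto

text \<open>Distinct decreasing words have distinct letter sets, hence distinct codes, so no carries
  occur in the sum and it is itself the code of a set.\<close>

lemma path_weight_eq_set_encode:
  "path_weight w r l = set_encode ((set_encode \<circ> set) ` paths w r l)"
proof -
  have "inj_on (set_encode \<circ> set) (paths w r l)"
    by (rule inj_on_subset[OF inj_on_encode_desc]) (auto simp: paths_def desc_subwords_def)
  then have "sum ((^) 2) ((set_encode \<circ> set) ` paths w r l) = path_weight w r l"
    unfolding path_weight_def by (subst sum.reindex) auto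
  then show ?thesis
    by (subst (1) set_encode_def) simp
qed

lemma path_weight_eqD:
  assumes "path_weight w r l = path_weight w' r l"
  shows "paths w r l = paths w' r l"
proof -
  have "(set_encode \<circ> set) ` paths w r l = (set_encode \<circ> set) ` paths w' r l"
    using assms by (simp add: path_weight_eq_set_encode set_encode_eq finite_paths)
  then show ?thesis
    by (subst (asm) inj_on_image_eq_iff[OF inj_on_encode_desc])
      (auto simp: paths_def desc_subwords_def)
qed

section \<open>The effect of appending a letter\<close>

lemma last_desc_le: "sorted_wrt (>) (r # x) \<Longrightarrow> y \<in> set (r # x) \<Longrightarrow> last (r # x) \<le> (y :: nat)"
proof (induction x arbitrary: r y)
  case (Cons a x)
  then have "last (a # x) \<le> a" "y = r \<or> y \<in> set (a # x)" "a < r"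
    by (auto simp del: last.simps)
  then show ?case
    using Cons.IH[of a a] Cons.IH[of a y] Cons.prems by (auto simp: last_ConsR simp del: last.simps)
qed simp

text \<open>Only words that are empty or end in \<open>l\<close> are tested for membership, and
  these cannot use the appended \<open>i\<close>.\<close>

lemma paths_snoc_other:
  assumes "l \<noteq> i"
  shows "paths (w @ [i]) r l = paths w r l"
proof -
  have "subseq x w" if x: "x = [] \<or> last x = l" "subseq x (w @ [i])" for x
  proof -
    obtain y z where x_eq: "x = y @ z" and "subseq y w" "subseq z [i]"
      using x by (auto simp: subseq_append_iff)
    moreover from \<open>subseq z [i]\<close> have "z = [] \<or> z = [i]"
      by (cases z) (auto split: if_splits)
    ultimately show ?thesis
      using x assms by auto
  qed
  then have "subseq x (w @ [i]) \<longleftrightarrow> subseq x w" if "x = [] \<or> last x = l" for x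
    using that by (auto intro: subseq_rev_drop_many)
  then show ?thesis
    by (auto simp: paths_def desc_subwords_def split: if_splits)
qed

lemma paths_snoc_same:
  assumes "r \<le> n"
  shows "paths (w @ [i]) r i = (\<lambda>x. x @ [i]) ` (\<Union>k\<in>{i<..n}. paths w r k)"
proof (intro equalityI subsetI)
  fix x assume x: "x \<in> paths (w @ [i]) r i"
  \<comment> \<open>The empty word would force \<open>r = i\<close>, but \<open>[i]\<close> is a
    subword of \<open>w @ [i]\<close>.\<close>
  have "x \<noteq> []"
    using x by (auto simp: paths_def desc_subwords_def)
  then obtain y where x_eq: "x = y @ [i]"
    using x by (cases x rule: rev_cases) (auto simp: paths_def)
  have snoc: "subseq (r # y @ [i]) (w @ [i]) \<longleftrightarrow> subseq (r # y) w"
    using subseq_append[of "r # y" "[i]" w] by simp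
  have y: "sorted_wrt (>) (r # y)" "\<forall>k\<in>set (r # y). i < k"
    using x by (auto simp: paths_def desc_subwords_def x_eq sorted_wrt_append)
  then have "last (r # y) \<in> {i<..n}"
    using assms last_desc_le[of r y r] last_in_set[of "r # y"] by (auto simp del: last.simps)
  moreover have "y \<in> paths w r (last (r # y))"
    using x y snoc by (auto simp: paths_def desc_subwords_def x_eq)
  ultimately show "x \<in> (\<lambda>x. x @ [i]) ` (\<Union>k\<in>{i<..n}. paths w r k)"
    unfolding x_eq by blast
next
  fix x assume "x \<in> (\<lambda>x. x @ [i]) ` (\<Union>k\<in>{i<..n}. paths w r k)"
  then obtain y k where x_eq: "x = y @ [i]" and y: "y \<in> paths w r k" and k: "i < k"
    by auto
  have snoc: "subseq (r # y @ [i]) (w @ [i]) \<longleftrightarrow> subseq (r # y) w"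
    using subseq_append[of "r # y" "[i]" w] by simp
  have "\<forall>z\<in>set (r # y). i < z"
    using y k last_desc_le[of r y] by (fastforce simp: paths_def desc_subwords_def simp del: last.simps)
  then show "x \<in> paths (w @ [i]) r i"
    using y snoc by (auto simp: paths_def desc_subwords_def x_eq sorted_wrt_append)
qed

lemma path_weight_Nil: "path_weight [] r l = (if l = r then 1 else 0)"
proof -
  have "paths [] r l = (if l = r then {[]} else {})"
    by (auto simp: paths_def desc_subwords_def)
  then show ?thesis
    by (simp add: path_weight_def)
qed

text \<open>This is right multiplication by the matrix of \<open>a_i\<close>: column
  \<open>i\<close> becomes \<open>2 ^ 2 ^ i\<close> times the sum of the columns after it. The
  factor splits off because \<open>i\<close> is new to each path.\<close>

lemma path_weight_snoc:
  assumes "r \<le> n"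
  shows "path_weight (w @ [i]) r l =
    (if l = i then 2 ^ 2 ^ i * (\<Sum>k\<in>{i<..n}. path_weight w r k) else path_weight w r l)"
proof (cases "l = i")
  case True
  have notin: "i \<notin> set x" if "x \<in> paths w r k" "i < k" for x k
    using that last_desc_le[of r x i] by (force simp: paths_def desc_subwords_def simp del: last.simps)
  have "path_weight (w @ [i]) r i =
      (\<Sum>x\<in>(\<Union>k\<in>{i<..n}. paths w r k). 2 ^ set_encode (set (x @ [i])))"
    unfolding path_weight_def paths_snoc_same[OF assms]
    by (subst sum.reindex) (auto simp: inj_on_def)
  also have "\<dots> = (\<Sum>x\<in>(\<Union>k\<in>{i<..n}. paths w r k). 2 ^ 2 ^ i * 2 ^ set_encode (set x))"
    using notin by (intro sum.cong) (auto simp: power_add)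
  also have "\<dots> = (\<Sum>k\<in>{i<..n}. \<Sum>x\<in>paths w r k. 2 ^ 2 ^ i * 2 ^ set_encode (set x))"
    \<comment> \<open>The union is disjoint because \<open>k\<close> is the last letter of
      \<open>r # x\<close>.\<close>
    by (rule sum.UNION_disjoint) (auto simp: finite_paths, auto simp: paths_def)
  finally show ?thesis
    using True by (simp add: path_weight_def sum_distrib_left)
qed (simp add: path_weight_def paths_snoc_other)

lemma word_mat_Nil: "word_mat n [] = 1\<^sub>m n"
  by (rule eq_matI) (auto simp: word_mat_def path_weight_Nil)

lemma word_mat_snoc:
  assumes "i \<in> {1..n}"
  shows "word_mat n (w @ [i]) = word_mat n w * word_mat n [i]"
proof (rule eq_matI)
  fix r l assume "r < dim_row (word_mat n w * word_mat n [i])"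
    "l < dim_col (word_mat n w * word_mat n [i])"
  then have rl: "r < n" "l < n"
    by (simp_all add: word_mat_def)
  \<comment> \<open>The recursion applied to the empty word gives the entries of the matrix of a
    single letter.\<close>
  have single: "path_weight [i] k (Suc l) =
      (if Suc l = i then if i < k then 2 ^ 2 ^ i else 0 else if Suc l = k then 1 else 0)"
    if "k \<le> n" for k
    using path_weight_snoc[OF that, of "[]" i "Suc l"] that by (simp add: path_weight_Nil)
  have "(word_mat n w * word_mat n [i]) $$ (r, l) =
      (\<Sum>k<n. path_weight w (Suc r) (Suc k) * path_weight [i] (Suc k) (Suc l))"
    using rl by (simp add: word_mat_def scalar_prod_def atLeast0LessThan)
  also have "\<dots> = (\<Sum>k\<in>{1..n}. path_weight w (Suc r) k * path_weight [i] k (Suc l))"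
    by (simp add: sum.atLeast1_atMost_eq)
  also have "\<dots> = path_weight (w @ [i]) (Suc r) (Suc l)"
  proof (cases "Suc l = i")
    case True
    have "(\<Sum>k\<in>{1..n}. path_weight w (Suc r) k * path_weight [i] k (Suc l)) =
        (\<Sum>k\<in>{i<..n}. path_weight w (Suc r) k * 2 ^ 2 ^ i)"
      using True single by (intro sum.mono_neutral_cong_right) auto
    then show ?thesis
      using True rl by (simp add: path_weight_snoc[of _ n] sum_distrib_right mult.commute)
  next
    case False
    have "(\<Sum>k\<in>{1..n}. path_weight w (Suc r) k * path_weight [i] k (Suc l)) =
        (\<Sum>k\<in>{Suc l}. path_weight w (Suc r) k * 1)"
      using False single rl by (intro sum.mono_neutral_cong_right) auto
    then show ?thesis
      using False rl by (simp add: path_weight_snoc[of _ n])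
  qed
  finally show "word_mat n (w @ [i]) $$ (r, l) = (word_mat n w * word_mat n [i]) $$ (r, l)"
    using rl by (simp add: word_mat_def)
qed (simp_all add: word_mat_def)

lemma word_mat_append:
  "v \<in> lists {1..n} \<Longrightarrow> word_mat n (u @ v) = word_mat n u * word_mat n v"
proof (induction v rule: rev_induct)
  case Nil
  then show ?case
    by (simp add: word_mat_Nil right_mult_one_mat[OF word_mat_carrier])
next
  case (snoc i v)
  then have "word_mat n ((u @ v) @ [i]) = word_mat n u * word_mat n v * word_mat n [i]"
    by (subst word_mat_snoc) auto
  also have "\<dots> = word_mat n u * (word_mat n v * word_mat n [i])"
    by (rule assoc_mult_mat[OF word_mat_carrier word_mat_carrier word_mat_carrier])
  finally show ?case
    using snoc word_mat_snoc[of i n v] by simp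
qed

text \<open>Equal entries give equal \<open>paths\<close>. Induction on \<open>x\<close> then
  decides whether \<open>r # x\<close> is a decreasing subword: given that \<open>x\<close> is one
  with all letters below \<open>r\<close>, this holds exactly when \<open>x\<close> is not in
  \<open>paths w r (last (r # x))\<close>.\<close>

lemma word_mat_eqD:
  assumes "word_mat n u = word_mat n v" "u \<in> lists {1..n}" "v \<in> lists {1..n}"
  shows "desc_subwords u = desc_subwords v"
proof -
  have paths: "paths u r l = paths v r l" if "r \<in> {1..n}" "l \<in> {1..n}" for r l
  proof (rule path_weight_eqD)
    show "path_weight u r l = path_weight v r l"
      using that arg_cong[OF assms(1), of "\<lambda>M. M $$ (r - 1, l - 1)"]
      by (auto simp: word_mat_def less_eq_Suc_le)
  qed
  have "x \<in> desc_subwords u \<longleftrightarrow> x \<in> desc_subwords v" if "x \<in> lists {1..n}" for x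
    using that
  proof (induction x rule: list.induct)
    case Nil
    show ?case by (simp add: desc_subwords_def)
  next
    case (Cons r x)
    have tail: "x \<in> desc_subwords w" if "r # x \<in> desc_subwords w" for w
      using that by (auto simp: desc_subwords_def dest: subseq_Cons')
    have "last (r # x) \<in> {1..n}"
      using Cons.prems last_in_set[of "r # x"] unfolding in_lists_conv_set by blast
    then have "paths u r (last (r # x)) = paths v r (last (r # x))"
      using Cons.prems by (intro paths) simp
    moreover have "r # x \<in> desc_subwords w \<longleftrightarrow> x \<in> desc_subwords w \<and> (\<forall>y\<in>set x. y < r)
        \<and> x \<notin> paths w r (last (r # x))" for w
    proof -
      have "\<forall>y\<in>set x. y < r" if "r # x \<in> desc_subwords w"
        using that by (simp add: desc_subwords_def)
      then show ?thesis
        using tail[of w] unfolding paths_def by blast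
    qed
    ultimately show ?case
      using Cons by simp
  qed
  moreover have "x \<in> lists {1..n}" if "x \<in> desc_subwords w" "w \<in> lists {1..n}" for x w
    using that(2) desc_subwords_set[OF that(1)] by auto
  ultimately show ?thesis
    using assms(2,3) by blast
qed

lemma word_mat_eq_iff:
  assumes "u \<in> lists {1..n}" "v \<in> lists {1..n}"
  shows "word_mat n u = word_mat n v \<longleftrightarrow> (u, v) \<in> kis_cong n"
proof
  assume "(u, v) \<in> kis_cong n"
  then have "desc_subwords u = desc_subwords v"
    by (rule desc_subwords_cong)
  then show "word_mat n u = word_mat n v"
    by (simp add: word_mat_def path_weight_def paths_def)
next
  assume "word_mat n u = word_mat n v"
  from word_mat_eqD[OF this assms] show "(u, v) \<in> kis_cong n"
    using kis_cong_iff_desc_subwords[OF assms] by blast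
qed

theorem theorem34:
  fixes n :: nat
  assumes "n \<ge> 1"
  shows "\<exists>\<phi>. \<phi> \<in> hom (kiselman n) (ring_mat TYPE(nat) n ()) \<and>
    \<phi> \<one>\<^bsub>kiselman n\<^esub> = \<one>\<^bsub>ring_mat TYPE(nat) n ()\<^esub> \<and>
    inj_on \<phi> (carrier (kiselman n))"
proof -
  \<comment> \<open>The choice of representative is harmless, since \<open>word_mat\<close> is
    constant on classes.\<close>
  define \<phi> where "\<phi> A = word_mat n (SOME w. w \<in> A)" for A
  let ?c = "\<lambda>w. kis_cong n `` {w}"
  have \<phi>: "\<phi> (?c w) = word_mat n w" if w: "w \<in> lists {1..n}" for w
  proof -
    have "(w, SOME v. v \<in> ?c w) \<in> kis_cong n"
      using someI[of "\<lambda>v. v \<in> ?c w" w] pres_cong.refl[OF w] by simp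
    then show ?thesis
      unfolding \<phi>_def using pres_cong_words[of w] by (metis word_mat_eq_iff)
  qed
  have rep: "\<exists>w\<in>lists {1..n}. A = ?c w" if "A \<in> carrier (kiselman n)" for A
    using that by (auto simp: kiselman_def carrier_presented_monoid elim: quotientE)
  have "\<phi> \<in> hom (kiselman n) (ring_mat TYPE(nat) n ())"
  proof (rule homI)
    fix A assume "A \<in> carrier (kiselman n)"
    then show "\<phi> A \<in> carrier (ring_mat TYPE(nat) n ())"
      by (simp add: \<phi>_def ring_mat_def)
  next
    fix A B assume "A \<in> carrier (kiselman n)" "B \<in> carrier (kiselman n)"
    then obtain u v where uv: "u \<in> lists {1..n}" "v \<in> lists {1..n}" "A = ?c u" "B = ?c v"
      using rep by meson
    then show "\<phi> (A \<otimes>\<^bsub>kiselman n\<^esub> B) = \<phi> A \<otimes>\<^bsub>ring_mat TYPE(nat) n ()\<^esub> \<phi> B"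
      using \<phi>[of "u @ v"]
      by (simp add: kiselman_def mult_presented_monoid \<phi> word_mat_append ring_mat_def del: One_nat_def)
  qed
  moreover have "\<phi> \<one>\<^bsub>kiselman n\<^esub> = \<one>\<^bsub>ring_mat TYPE(nat) n ()\<^esub>"
    using \<phi>[of "[]"] by (simp add: kiselman_def one_presented_monoid word_mat_Nil ring_mat_def)
  moreover have "inj_on \<phi> (carrier (kiselman n))"
  proof (rule inj_onI)
    fix A B assume "A \<in> carrier (kiselman n)" "B \<in> carrier (kiselman n)" and eq: "\<phi> A = \<phi> B"
    then obtain u v where uv: "u \<in> lists {1..n}" "v \<in> lists {1..n}" "A = ?c u" "B = ?c v"
      using rep by meson
    then have "(u, v) \<in> kis_cong n"
      using eq \<phi> word_mat_eq_iff by metis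
    then show "A = B"
      using uv equiv_class_eq[OF equiv_pres_cong] by blast
  qed
  ultimately show ?thesis by blast
qed

end
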